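(* Set $\hbar=1$. On the one-mode radial family $\{\nu G(r,\varphi):\nu>1/2\}$ at fixed $(r,\varphi)$, with $V=\nu\partial_\nu$ and $\Phi(\nu)=-\frac12\log(\nu^2-\frac14)$, one has $$V=-\frac14\operatorname{grad}_{\rm B}\Phi,\qquad \lVert V\rVert_{\rm B}^2=-\frac14V(\Phi).$$ These identities extend additively to the fixed-Williamson-frame radial manifold $\mathcal M_{S_W}$, with $V=\sum_{k=1}^N\nu_k\partial_{\nu_k}$ and $\Phi=-\frac12\sum_{k=1}^N\log(\nu_k^2-\frac14)$, whenever the radial quantum Fisher information is a direct sum of independent one-mode blocks.
   Context: $G(r,\varphi)=R(\varphi)\operatorname{diag}(e^{2r},e^{-2r})R(\varphi)^{\mathsf T}$ with $R(\varphi)$ the $2\times2$ rotation by $\varphi$. $\operatorname{grad}_{\rm B}$ and $\lVert\cdot\rVert_{\rm B}$ are the gradient and norm of the Bures metric $g^{\rm B}=\frac14F$, where the one-mode radial quantum Fisher information is $F_{\nu\nu}=\frac{1}{\nu^2-\frac14}$, so $g^{\rm B}_{\nu\nu}=\frac{1}{4(\nu^2-\frac14)}$. The radial manifold is $\mathcal M_{S_W}=\{S_W(\bigoplus_{k=1}^N\nu_k\mathbb 1_2)S_W^{\mathsf T}:\nu_k>\frac12\}$ for a fixed symplectic matrix $S_W$ (i.e. $S_W\Omega S_W^{\mathsf T}=\Omega$, $\Omega=\bigoplus_{k=1}^N\begin{pmatrix}0&1\\-1&0\end{pmatrix}$). The direct-sum hypothesis means that in the coordinates $(\nu_1,\dots,\nu_N)$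 the Bures metric on $\mathcal M_{S_W}$ is $\sum_k\frac{d\nu_k^2}{4(\nu_k^2-\frac14)}$. *)

theory Defs
  imports "HOL-Analysis.Analysis"
begin

text \<open>
  Embedded manifolds carrying one global chart: \<^term>\<open>U\<close> is an open coordinate domain, \<^term>\<open>x\<close> the
  parametrisation, and the manifold is the image \<^term>\<open>x ` U\<close>. Tangent vectors are elements of the
  ambient space, and \<^term>\<open>coords U x\<close> is the chart, meaningful on the image only.
\<close>

definition coords :: "'p set \<Rightarrow> ('p \<Rightarrow> 'm) \<Rightarrow> 'm \<Rightarrow> 'p" where
  "coords U x p = inv_into U x p"

text \<open>The differential of the parametrisation. On basis vectors of the coordinate space it gives the
  coordinate vector fields.\<close>

definition tangent_map ::
    "'p::euclidean_space set \<Rightarrow> ('p \<Rightarrow> 'm::euclidean_space) \<Rightarrow> 'm \<Rightarrow> 'p \<Rightarrow> 'm" where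
  "tangent_map U x p = frechet_derivative x (at (coords U x p))"

definition tangent_space ::
    "'p::euclidean_space set \<Rightarrow> ('p \<Rightarrow> 'm::euclidean_space) \<Rightarrow> 'm \<Rightarrow> 'm set" where
  "tangent_space U x p = range (tangent_map U x p)"

text \<open>Components of a tangent vector in the coordinate frame.\<close>

definition components ::
    "'p::euclidean_space set \<Rightarrow> ('p \<Rightarrow> 'm::euclidean_space) \<Rightarrow> 'm \<Rightarrow> 'm \<Rightarrow> 'p" where
  "components U x p w = inv (tangent_map U x p) w"

text \<open>The derivative of a scalar function on the manifold along a tangent vector at a point.\<close>

definition differential ::
    "'p::euclidean_space set \<Rightarrow> ('p \<Rightarrow> 'm::euclidean_space) \<Rightarrow> ('m \<Rightarrow> real) \<Rightarrow> 'm \<Rightarrow> 'm \<Rightarrow> real" where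
  "differential U x f p w =
     frechet_derivative (f \<circ> x) (at (coords U x p)) (components U x p w)"

definition gradient ::
    "'p::euclidean_space set \<Rightarrow> ('p \<Rightarrow> 'm::euclidean_space) \<Rightarrow> ('m \<Rightarrow> 'm \<Rightarrow> 'm \<Rightarrow> real) \<Rightarrow>
     ('m \<Rightarrow> real) \<Rightarrow> 'm \<Rightarrow> 'm" where
  "gradient U x g f p =
     (THE X. X \<in> tangent_space U x p \<and>
             (\<forall>w \<in> tangent_space U x p. g p X w = differential U x f p w))"

definition metric_norm :: "('m \<Rightarrow> 'm \<Rightarrow> 'm \<Rightarrow> real) \<Rightarrow> 'm \<Rightarrow> 'm \<Rightarrow> real" where
  "metric_norm g p v = sqrt (g p v v)"

text \<open>The Bures metric is one quarter of the quantum Fisher information. Here \<^term>\<open>F u a b\<close> is the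
  quantum Fisher information form at the coordinate point \<^term>\<open>u\<close> on coordinate components
  \<^term>\<open>a\<close>, \<^term>\<open>b\<close>.\<close>

definition bures_metric ::
    "'p::euclidean_space set \<Rightarrow> ('p \<Rightarrow> 'm::euclidean_space) \<Rightarrow> ('p \<Rightarrow> 'p \<Rightarrow> 'p \<Rightarrow> real) \<Rightarrow>
     'm \<Rightarrow> 'm \<Rightarrow> 'm \<Rightarrow> real" where
  "bures_metric U x F p v w =
     1/4 * F (coords U x p) (components U x p v) (components U x p w)"

text \<open>One mode, with \<open>\<hbar> = 1\<close>, so that the vacuum has symplectic eigenvalue \<open>1/2\<close>.\<close>

definition rot :: "real \<Rightarrow> real^2^2" where
  "rot \<phi> = vector [vector [cos \<phi>, - sin \<phi>], vector [sin \<phi>, cos \<phi>]]"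

definition G :: "real \<Rightarrow> real \<Rightarrow> real^2^2" where
  "G r \<phi> = rot \<phi> ** vector [vector [exp (2 * r), 0], vector [0, exp (- 2 * r)]]
             ** transpose (rot \<phi>)"

definition one_mode_dom :: "real set" where
  "one_mode_dom = {\<nu>. \<nu> > 1/2}"

definition one_mode_param :: "real \<Rightarrow> real \<Rightarrow> real \<Rightarrow> real^2^2" where
  "one_mode_param r \<phi> \<nu> = \<nu> *\<^sub>R G r \<phi>"

definition one_mode_family :: "real \<Rightarrow> real \<Rightarrow> (real^2^2) set" where
  "one_mode_family r \<phi> = one_mode_param r \<phi> ` one_mode_dom"

definition one_mode_qfi :: "real \<Rightarrow> real" where
  "one_mode_qfi \<nu> = 1 / (\<nu>\<^sup>2 - 1/4)"

definition one_mode_bures :: "real \<Rightarrow> real \<Rightarrow> real^2^2 \<Rightarrow> real^2^2 \<Rightarrow> real^2^2 \<Rightarrow> real" where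
  "one_mode_bures r \<phi> =
     bures_metric one_mode_dom (one_mode_param r \<phi>) (\<lambda>\<nu> a b. one_mode_qfi \<nu> * a * b)"

definition one_mode_grad :: "real \<Rightarrow> real \<Rightarrow> (real^2^2 \<Rightarrow> real) \<Rightarrow> real^2^2 \<Rightarrow> real^2^2" where
  "one_mode_grad r \<phi> =
     gradient one_mode_dom (one_mode_param r \<phi>) (one_mode_bures r \<phi>)"

definition one_mode_V :: "real \<Rightarrow> real \<Rightarrow> real^2^2 \<Rightarrow> real^2^2" where
  "one_mode_V r \<phi> p =
     coords one_mode_dom (one_mode_param r \<phi>) p
       *\<^sub>R tangent_map one_mode_dom (one_mode_param r \<phi>) p 1"

definition one_mode_Phi :: "real \<Rightarrow> real \<Rightarrow> real^2^2 \<Rightarrow> real" where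
  "one_mode_Phi r \<phi> p =
     - 1/2 * ln ((coords one_mode_dom (one_mode_param r \<phi>) p)\<^sup>2 - 1/4)"

text \<open>
  \<open>N\<close> modes: the finite index type \<open>'n\<close> has \<open>N\<close> elements, and phase space has the coordinates
  indexed by pairs of a mode and one of its two quadratures.
\<close>

definition block_diag :: "('n \<Rightarrow> real^2^2) \<Rightarrow> real^('n::finite \<times> 2)^('n \<times> 2)" where
  "block_diag A = (\<chi> i j. if fst i = fst j then A (fst i) $ snd i $ snd j else 0)"

definition Omega :: "real^('n::finite \<times> 2)^('n \<times> 2)" where
  "Omega = block_diag (\<lambda>_. vector [vector [0, 1], vector [- 1, 0]])"

definition symplectic :: "real^('n::finite \<times> 2)^('n \<times> 2) \<Rightarrow> bool" where
  "symplectic S \<longleftrightarrow> S ** Omega ** transpose S = Omega"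

definition radial_dom :: "(real^'n::finite) set" where
  "radial_dom = {\<nu>. \<forall>k. \<nu> $ k > 1/2}"

definition radial_param ::
    "real^('n::finite \<times> 2)^('n \<times> 2) \<Rightarrow> real^'n \<Rightarrow> real^('n \<times> 2)^('n \<times> 2)" where
  "radial_param S \<nu> = S ** block_diag (\<lambda>k. \<nu> $ k *\<^sub>R mat 1) ** transpose S"

definition radial_manifold ::
    "real^('n::finite \<times> 2)^('n \<times> 2) \<Rightarrow> (real^('n \<times> 2)^('n \<times> 2)) set" where
  "radial_manifold S = radial_param S ` radial_dom"

text \<open>The radial quantum Fisher information matrix, as a function of the symplectic eigenvalues, is a
  direct sum of one-mode blocks.\<close>

definition direct_sum_qfi :: "(real^'n::finite \<Rightarrow> real^'n^'n) \<Rightarrow> bool" where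
  "direct_sum_qfi F \<longleftrightarrow>
     (\<forall>\<nu> \<in> radial_dom. \<forall>k l. F \<nu> $ k $ l = (if k = l then one_mode_qfi (\<nu> $ k) else 0))"

definition radial_bures ::
    "real^('n::finite \<times> 2)^('n \<times> 2) \<Rightarrow> (real^'n \<Rightarrow> real^'n^'n) \<Rightarrow> real^('n \<times> 2)^('n \<times> 2) \<Rightarrow>
     real^('n \<times> 2)^('n \<times> 2) \<Rightarrow> real^('n \<times> 2)^('n \<times> 2) \<Rightarrow> real" where
  "radial_bures S F =
     bures_metric radial_dom (radial_param S)
       (\<lambda>\<nu> a b. \<Sum>k\<in>UNIV. \<Sum>l\<in>UNIV. F \<nu> $ k $ l * a $ k * b $ l)"

definition radial_grad ::
    "real^('n::finite \<times> 2)^('n \<times> 2) \<Rightarrow> (real^'n \<Rightarrow> real^'n^'n) \<Rightarrow>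
     (real^('n \<times> 2)^('n \<times> 2) \<Rightarrow> real) \<Rightarrow> real^('n \<times> 2)^('n \<times> 2) \<Rightarrow> real^('n \<times> 2)^('n \<times> 2)" where
  "radial_grad S F = gradient radial_dom (radial_param S) (radial_bures S F)"

definition radial_V ::
    "real^('n::finite \<times> 2)^('n \<times> 2) \<Rightarrow> real^('n \<times> 2)^('n \<times> 2) \<Rightarrow> real^('n \<times> 2)^('n \<times> 2)" where
  "radial_V S p =
     (\<Sum>k\<in>UNIV. coords radial_dom (radial_param S) p $ k
                 *\<^sub>R tangent_map radial_dom (radial_param S) p (axis k 1))"

definition radial_Phi ::
    "real^('n::finite \<times> 2)^('n \<times> 2) \<Rightarrow> real^('n \<times> 2)^('n \<times> 2) \<Rightarrow> real" where
  "radial_Phi S p =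
     - 1/2 * (\<Sum>k\<in>UNIV. ln ((coords radial_dom (radial_param S) p $ k)\<^sup>2 - 1/4))"

end

theory Submission imports Defs begin

text \<open>
  Both parametrisations are restrictions of injective linear maps, so in the chart the tangent map is
  the parametrisation itself and the dilation field \<^term>\<open>V\<close> at the point with coordinates
  \<^term>\<open>u\<close> has components \<^term>\<open>u\<close>. Everything then reduces to \<open>d\<Phi>(u)(b) = - F u u b\<close>, together
  with positive definiteness of the quantum Fisher information \<^term>\<open>F u\<close>, by which the gradient is
  unique.
\<close>

section \<open>Linear charts\<close>

lemma coords_param:
  assumes "inj x" "u \<in> U"
  shows "coords U x (x u) = u"
  using assms by (simp add: coords_def inj_on_subset[OF _ subset_UNIV])

lemma tangent_map_linear:
  assumes "linear x" "inj x" "u \<in> U"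
  shows "tangent_map U x (x u) = x"
proof -
  have "(x has_derivative x) (at u)"
    using assms(1) by (simp add: linear_imp_has_derivative)
  then show ?thesis
    unfolding tangent_map_def coords_param[OF assms(2,3)]
    by (metis frechet_derivative_at)
qed

lemma components_linear:
  assumes "linear x" "inj x" "u \<in> U"
  shows "components U x (x u) (x a) = a"
  using assms by (simp add: components_def tangent_map_linear)

text \<open>The chart inverts \<open>x\<close> only on the image of \<open>U\<close>, so the
  composite with \<open>x\<close> agrees with \<open>h\<close> on \<open>U\<close> alone. Openness
  of \<open>U\<close> makes this agreement a neighbourhood of \<open>u\<close>, which lets the
  derivative carry over.\<close>

lemma differential_linear:
  assumes "linear x" "inj x" "open U" "u \<in> U"
    and h: "(h has_derivative h') (at u)"
  shows "differential U x (\<lambda>p. h (coords U x p)) (x u) (x b) = h' b"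
proof -
  have "(((\<lambda>p. h (coords U x p)) \<circ> x) has_derivative h') (at u)"
    by (rule has_derivative_transform_within_open[OF h assms(3,4)])
      (simp add: coords_param assms)
  then have "frechet_derivative ((\<lambda>p. h (coords U x p)) \<circ> x) (at u) = h'"
    by (metis frechet_derivative_at)
  then show ?thesis
    using assms by (simp add: differential_def coords_param components_linear)
qed

lemma bures_metric_linear:
  assumes "linear x" "inj x" "u \<in> U"
  shows "bures_metric U x F (x u) (x a) (x b) = 1/4 * F u a b"
  using assms by (simp add: bures_metric_def coords_param components_linear)

lemma gradient_linear:
  assumes x: "linear x" "inj x" "open U" "u \<in> U"
    and h: "(h has_derivative h') (at u)"
    and F: "bilinear (F u)" "\<And>a. a \<noteq> 0 \<Longrightarrow> F u a a > 0"
    and a: "\<And>b. 1/4 * F u a b = h' b"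
  shows "gradient U x (bures_metric U x F) (\<lambda>p. h (coords U x p)) (x u) = x a"
  unfolding gradient_def
proof (rule the_equality)
  have T: "tangent_space U x (x u) = range x"
    using x by (simp add: tangent_space_def tangent_map_linear)
  show "x a \<in> tangent_space U x (x u) \<and>
      (\<forall>w\<in>tangent_space U x (x u). bures_metric U x F (x u) (x a) w =
        differential U x (\<lambda>p. h (coords U x p)) (x u) w)"
    unfolding T using a x
    by (auto simp: bures_metric_linear differential_linear[OF x h])
  fix X
  assume X: "X \<in> tangent_space U x (x u) \<and>
      (\<forall>w\<in>tangent_space U x (x u). bures_metric U x F (x u) X w =
        differential U x (\<lambda>p. h (coords U x p)) (x u) w)"
  then obtain c where c: "X = x c"
    using T by auto
  have "1/4 * F u c b = h' b" for b
    using X x unfolding T c by (auto simp: bures_metric_linear differential_linear[OF x h])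
  \<comment> \<open>Both candidates represent the functional \<open>h'\<close>. Testing them on
    their own difference leaves the quadratic form at \<open>c - a\<close>, which vanishes only at
    zero.\<close>
  then have "F u c (c - a) = F u a (c - a)"
    using a[of "c - a"] by (metis mult_left_cancel zero_neq_one divide_eq_0_iff zero_neq_numeral)
  then have "F u (c - a) (c - a) = 0"
    using F(1) by (simp add: bilinear_lsub)
  then have "c = a"
    using F(2)[of "c - a"] by force
  then show "X = x a"
    using c by simp
qed

text \<open>The tangent vector at \<open>x u\<close> is \<open>x u\<close> itself, with components
  \<open>u\<close>. Assumption \<open>h\<close> says that the potential has differential minus the
  information form paired with \<open>u\<close>. Both identities follow by comparing this with the
  metric, a quarter of that form.\<close>

lemma dilation_field_identities:
  assumes x: "linear x" "inj x" "open U" "u \<in> U"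
    and F: "bilinear (F u)" "\<And>a. a \<noteq> 0 \<Longrightarrow> F u a a > 0"
    and h: "(h has_derivative (\<lambda>b. - F u u b)) (at u)"
  shows "x u = (- 1/4) *\<^sub>R gradient U x (bures_metric U x F) (\<lambda>p. h (coords U x p)) (x u)"
    and "(metric_norm (bures_metric U x F) (x u) (x u))\<^sup>2 =
      - 1/4 * differential U x (\<lambda>p. h (coords U x p)) (x u) (x u)"
proof -
  \<comment> \<open>The gradient has components \<open>-4 u\<close>: the 4 undoes the Bures factor
    1/4, and the sign is that of the derivative of \<open>h\<close>.\<close>
  have a: "1/4 * F u ((- 4) *\<^sub>R u) b = - F u u b" for b
    using bilinear_lmul[OF F(1), of "- 4" u b] by simp
  have "gradient U x (bures_metric U x F) (\<lambda>p. h (coords U x p)) (x u) = x ((- 4) *\<^sub>R u)"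
    by (rule gradient_linear[OF x h]) (use F a in auto)
  then show "x u = (- 1/4) *\<^sub>R gradient U x (bures_metric U x F) (\<lambda>p. h (coords U x p)) (x u)"
    using x(1) by (simp only: linear_scale) simp
  \<comment> \<open>Squaring the square root in \<open>metric_norm\<close> returns the form only if
    it is nonnegative. Positivity is assumed for nonzero vectors, so \<open>u = 0\<close> is treated
    apart.\<close>
  have "F u u u \<ge> 0"
    using F(2)[of u] bilinear_lzero[OF F(1), of u] by (cases "u = 0") auto
  then show "(metric_norm (bures_metric U x F) (x u) (x u))\<^sup>2 =
      - 1/4 * differential U x (\<lambda>p. h (coords U x p)) (x u) (x u)"
    using x by (simp add: metric_norm_def bures_metric_linear differential_linear[OF x h])
qed

section \<open>One mode\<close>

lemma radicand_pos:
  fixes \<nu> :: real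
  assumes "\<nu> > 1/2"
  shows "\<nu>\<^sup>2 - 1/4 > 0"
  using power_strict_mono[OF assms, of 2] by (simp add: power2_eq_square)

lemma one_mode_qfi_pos: "\<nu> > 1/2 \<Longrightarrow> one_mode_qfi \<nu> > 0"
  using radicand_pos[of \<nu>] by (simp add: one_mode_qfi_def)

text \<open>By the chain rule the derivative is \<open>- f u * f' b / ((f u)\<^sup>2 - 1/4)\<close>,
  whose denominator is exactly that of the quantum Fisher information. Keeping \<open>f\<close>
  general covers both the single coordinate and each component of a vector of symplectic
  eigenvalues.\<close>

lemma has_derivative_half_ln:
  fixes f :: "'a::real_normed_vector \<Rightarrow> real"
  assumes f: "(f has_derivative f') (at u)" and u: "f u > 1/2"
  shows "((\<lambda>u. - 1/2 * ln ((f u)\<^sup>2 - 1/4)) has_derivative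
    (\<lambda>b. - (one_mode_qfi (f u) * f u * f' b))) (at u)"
  unfolding one_mode_qfi_def
  by (rule derivative_eq_intros f refl | use radicand_pos[OF u] in force)+
    (auto simp: field_simps)

text \<open>This makes the one-mode chart injective. The upper left entry combines the squares of
  cosine and sine with positive weights, and these squares never vanish together.\<close>

lemma G_nonzero: "G r \<phi> \<noteq> 0"
proof -
  have "G r \<phi> $ 1 $ 1 = exp (2 * r) * (cos \<phi>)\<^sup>2 + exp (- 2 * r) * (sin \<phi>)\<^sup>2"
    by (simp add: G_def rot_def matrix_matrix_mult_def transpose_def sum_2 vector_2
        power2_eq_square)
  moreover have "\<dots> > 0"
    using sin_cos_squared_add[of \<phi>]
    by (cases "cos \<phi> = 0") (auto intro: add_pos_nonneg)
  ultimately show ?thesis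
    by auto
qed

lemma linear_one_mode_param: "linear (one_mode_param r \<phi>)"
  unfolding one_mode_param_def by (rule linearI) (auto simp: algebra_simps)

lemma inj_one_mode_param: "inj (one_mode_param r \<phi>)"
  by (rule injI) (simp add: one_mode_param_def G_nonzero)

lemma open_one_mode_dom: "open one_mode_dom"
  unfolding one_mode_dom_def by (simp add: open_Collect_less)

lemma one_mode_V_param:
  assumes "u \<in> one_mode_dom"
  shows "one_mode_V r \<phi> (one_mode_param r \<phi> u) = one_mode_param r \<phi> u"
  using assms linear_one_mode_param inj_one_mode_param
  by (simp add: one_mode_V_def coords_param tangent_map_linear) (simp add: one_mode_param_def)

lemma one_mode_identities:
  assumes "p \<in> one_mode_family r \<phi>"
  shows "one_mode_V r \<phi> p = (- 1/4) *\<^sub>R one_mode_grad r \<phi> (one_mode_Phi r \<phi>) p"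
    and "(metric_norm (one_mode_bures r \<phi>) p (one_mode_V r \<phi> p))\<^sup>2 =
      - 1/4 * differential one_mode_dom (one_mode_param r \<phi>) (one_mode_Phi r \<phi>) p
                (one_mode_V r \<phi> p)"
proof -
  obtain u where u: "u \<in> one_mode_dom" and p: "p = one_mode_param r \<phi> u"
    using assms by (auto simp: one_mode_family_def)
  have u': "u > 1/2"
    using u by (simp add: one_mode_dom_def)
  let ?F = "\<lambda>\<nu> a b. one_mode_qfi \<nu> * a * b"
  have bil: "bilinear (?F u)"
    unfolding bilinear_def by (auto intro!: linearI simp: algebra_simps)
  have pos: "?F u a a > 0" if "a \<noteq> 0" for a
    using that one_mode_qfi_pos[OF u'] by (auto simp: mult.assoc zero_less_mult_iff)
  have der: "((\<lambda>\<nu>. - 1/2 * ln (\<nu>\<^sup>2 - 1/4)) has_derivative (\<lambda>b. - ?F u u b)) (at u)"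
    by (rule has_derivative_half_ln[OF has_derivative_ident u'])
  \<comment> \<open>The potential is displayed as a function of the chart, the shape required by
    \<open>dilation_field_identities\<close>.\<close>
  have Phi: "one_mode_Phi r \<phi> =
      (\<lambda>p. - 1/2 * ln ((coords one_mode_dom (one_mode_param r \<phi>) p)\<^sup>2 - 1/4))"
    by (simp add: one_mode_Phi_def fun_eq_iff)
  note ids = dilation_field_identities[where F = ?F and x = "one_mode_param r \<phi>",
      OF linear_one_mode_param inj_one_mode_param open_one_mode_dom u bil pos der]
  show "one_mode_V r \<phi> p = (- 1/4) *\<^sub>R one_mode_grad r \<phi> (one_mode_Phi r \<phi>) p"
    unfolding p one_mode_V_param[OF u] one_mode_grad_def one_mode_bures_def Phi by (rule ids(1))
  show "(metric_norm (one_mode_bures r \<phi>) p (one_mode_V r \<phi> p))\<^sup>2 =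
      - 1/4 * differential one_mode_dom (one_mode_param r \<phi>) (one_mode_Phi r \<phi>) p
                (one_mode_V r \<phi> p)"
    unfolding p one_mode_V_param[OF u] one_mode_bures_def Phi by (rule ids(2))
qed

section \<open>The radial manifold\<close>

lemma block_diag_mult: "block_diag A ** block_diag B = block_diag (\<lambda>k. A k ** B k)"
proof -
  have "(\<Sum>l\<in>UNIV. block_diag A $ i $ l * block_diag B $ l $ j) =
      block_diag (\<lambda>k. A k ** B k) $ i $ j" for i j
  proof -
    have "(\<Sum>l\<in>UNIV. block_diag A $ i $ l * block_diag B $ l $ j) =
        (\<Sum>k\<in>UNIV. \<Sum>s\<in>UNIV. block_diag A $ i $ (k, s) * block_diag B $ (k, s) $ j)"
      by (simp add: sum.cartesian_product flip: UNIV_Times_UNIV)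
    \<comment> \<open>Row \<open>i\<close> of the first factor is zero outside the block of its own
      mode \<open>fst i\<close>.\<close>
    also have "\<dots> = (\<Sum>k\<in>UNIV. if k = fst i then
        (\<Sum>s\<in>UNIV. block_diag A $ i $ (k, s) * block_diag B $ (k, s) $ j) else 0)"
      by (rule sum.cong) (auto simp: block_diag_def)
    also have "\<dots> = block_diag (\<lambda>k. A k ** B k) $ i $ j"
      by (auto simp: block_diag_def matrix_matrix_mult_def)
    finally show ?thesis .
  qed
  then show ?thesis
    by (simp add: vec_eq_iff matrix_matrix_mult_def)
qed

lemma block_diag_mat: "block_diag (\<lambda>_. mat c) = mat c"
  by (auto simp: block_diag_def mat_def vec_eq_iff)

text \<open>Each block squares to minus the identity, so its negative \<open>?K\<close> inverts it
  block by block.\<close>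

lemma invertible_Omega: "invertible Omega"
proof -
  let ?J = "vector [vector [0, 1], vector [- 1, 0]] :: real^2^2"
  let ?K = "vector [vector [0, - 1], vector [1, 0]] :: real^2^2"
  have "?J ** ?K = mat 1" "?K ** ?J = mat 1"
    by (simp_all add: vec_eq_iff forall_2 matrix_matrix_mult_def sum_2 mat_def)
  then show ?thesis
    unfolding invertible_def Omega_def
    by (intro exI[of _ "block_diag (\<lambda>_. ?K)"]) (simp add: block_diag_mult block_diag_mat)
qed

text \<open>Taking determinants in the defining relation, a zero determinant of \<open>S\<close>
  would force that of \<open>Omega\<close> to vanish.\<close>

lemma symplectic_invertible:
  assumes "symplectic S"
  shows "invertible S"
proof -
  have "det (S ** Omega ** transpose S) = det (Omega :: real^('a \<times> 2)^('a \<times> 2))"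
    using assms by (simp add: symplectic_def)
  moreover have "det (Omega :: real^('a \<times> 2)^('a \<times> 2)) \<noteq> 0"
    using invertible_Omega by (simp add: invertible_det_nz)
  ultimately have "det S \<noteq> 0"
    by (auto simp: det_mul)
  then show ?thesis
    by (simp add: invertible_det_nz)
qed

lemma congruence_cancel:
  fixes S :: "real^'n^'n"
  assumes "invertible S" "S ** A ** transpose S = S ** B ** transpose S"
  shows "A = B"
proof -
  obtain T where T: "T ** S = mat 1"
    using assms(1) by (auto simp: invertible_def)
  then have "transpose S ** transpose T = mat 1"
    by (metis matrix_transpose_mul transpose_mat)
  then have "C = T ** (S ** C ** transpose S) ** transpose T" for C
    using T by (metis matrix_mul_assoc matrix_mul_lid matrix_mul_rid)
  then show ?thesis
    using assms(2) by metis
qed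

section \<open>The radial chart\<close>

lemma linear_congruence: "linear (\<lambda>A. S ** A ** transpose S)"
  for S :: "real^'n^'m"
  by (rule linearI)
    (simp_all add: vec_eq_iff matrix_matrix_mult_def distrib_left distrib_right sum.distrib
      sum_distrib_left sum_distrib_right mult_ac)

lemma linear_radial_param: "linear (radial_param S)"
  for S :: "real^('n::finite \<times> 2)^('n \<times> 2)"
proof -
  have "linear (\<lambda>\<nu> :: real^'n. block_diag (\<lambda>k. \<nu> $ k *\<^sub>R mat 1))"
    by (rule linearI) (simp_all add: block_diag_def vec_eq_iff algebra_simps)
  from linear_compose[OF this linear_congruence[of S]] show ?thesis
    by (simp add: radial_param_def[abs_def] comp_def)
qed

lemma inj_radial_param:
  assumes "symplectic S"
  shows "inj (radial_param S)"
proof (rule injI)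
  fix a b
  assume "radial_param S a = radial_param S b"
  then have "block_diag (\<lambda>k. a $ k *\<^sub>R mat 1) = block_diag (\<lambda>k. b $ k *\<^sub>R mat 1)"
    unfolding radial_param_def by (rule congruence_cancel[OF symplectic_invertible[OF assms]])
  \<comment> \<open>After \<open>S\<close> is cancelled, each eigenvalue is read off from one
    diagonal entry of its block.\<close>
  then have "block_diag (\<lambda>k. a $ k *\<^sub>R mat 1) $ (k, 1) $ (k, 1) =
      block_diag (\<lambda>k. b $ k *\<^sub>R mat 1) $ (k, 1) $ (k, 1)" for k
    by simp
  then show "a = b"
    by (simp add: block_diag_def mat_def vec_eq_iff)
qed

lemma open_radial_dom: "open radial_dom"
proof -
  have "open (\<Inter>k. {\<nu> :: real^'a. 1/2 < \<nu> $ k})"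
    by (intro open_INT ballI finite open_Collect_less continuous_intros)
  also have "(\<Inter>k. {\<nu> :: real^'a. 1/2 < \<nu> $ k}) = radial_dom"
    by (auto simp: radial_dom_def)
  finally show ?thesis .
qed

lemma radial_V_param:
  assumes "symplectic S" "u \<in> radial_dom"
  shows "radial_V S (radial_param S u) = radial_param S u"
proof -
  note lin = linear_radial_param[of S] and inj = inj_radial_param[OF assms(1)]
  have "radial_V S (radial_param S u) = (\<Sum>k\<in>UNIV. u $ k *\<^sub>R radial_param S (axis k 1))"
    unfolding radial_V_def tangent_map_linear[OF lin inj assms(2)]
      coords_param[OF inj assms(2)] ..
  also have "\<dots> = radial_param S (\<Sum>k\<in>UNIV. u $ k *\<^sub>R axis k 1)"
    by (simp add: linear_sum[OF lin] linear_scale[OF lin])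
  also have "(\<Sum>k\<in>UNIV. u $ k *\<^sub>R axis k 1) = u"
    using basis_expansion[of u] by (simp add: scalar_mult_eq_scaleR)
  finally show ?thesis .
qed

section \<open>The identities for several modes\<close>

lemma radial_identities:
  assumes S: "symplectic S" and F: "direct_sum_qfi F" and p: "p \<in> radial_manifold S"
  shows "radial_V S p = (- 1/4) *\<^sub>R radial_grad S F (radial_Phi S) p"
    and "(metric_norm (radial_bures S F) p (radial_V S p))\<^sup>2 =
      - 1/4 * differential radial_dom (radial_param S) (radial_Phi S) p (radial_V S p)"
proof -
  obtain u where u: "u \<in> radial_dom" and pu: "p = radial_param S u"
    using p by (auto simp: radial_manifold_def)
  have u': "u $ k > 1/2" for k
    using u by (simp add: radial_dom_def)
  let ?F = "\<lambda>\<nu> a b. \<Sum>k\<in>UNIV. \<Sum>l\<in>UNIV. F \<nu> $ k $ l * a $ k * b $ l"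
  \<comment> \<open>The direct-sum hypothesis, available because \<open>u\<close> lies in
    \<open>radial_dom\<close>, removes the cross terms between modes.\<close>
  have diag: "?F u a b = (\<Sum>k\<in>UNIV. one_mode_qfi (u $ k) * a $ k * b $ k)" for a b
  proof (rule sum.cong[OF refl])
    fix k
    have "(\<Sum>l\<in>UNIV. F u $ k $ l * a $ k * b $ l) =
        (\<Sum>l\<in>UNIV. if l = k then one_mode_qfi (u $ k) * a $ k * b $ k else 0)"
      using F u by (intro sum.cong) (auto simp: direct_sum_qfi_def)
    then show "(\<Sum>l\<in>UNIV. F u $ k $ l * a $ k * b $ l) = one_mode_qfi (u $ k) * a $ k * b $ k"
      by simp
  qed
  have bil: "bilinear (?F u)"
    unfolding diag bilinear_def
    by (auto intro!: linearI simp: algebra_simps sum.distrib sum_distrib_left)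
  have pos: "?F u a a > 0" if "a \<noteq> 0" for a
  proof -
    \<comment> \<open>One nonzero component gives a strictly positive summand, and all the others
      are nonnegative.\<close>
    have "\<exists>k. a $ k \<noteq> 0"
      using that by (simp add: vec_eq_iff)
    then obtain k where "a $ k \<noteq> 0" ..
    then have "one_mode_qfi (u $ k) * a $ k * a $ k > 0"
      using one_mode_qfi_pos[OF u', of k]
      by (auto simp: mult.assoc zero_less_mult_iff)
    moreover have "one_mode_qfi (u $ j) * a $ j * a $ j \<ge> 0" for j
      using one_mode_qfi_pos[OF u', of j] by (simp add: mult.assoc)
    ultimately show ?thesis
      unfolding diag by (intro sum_pos2[of _ k]) auto
  qed
  \<comment> \<open>The factor -1/2 is placed inside the sum so that the one-mode derivative applies
    to each summand; it is pulled out again afterwards.\<close>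
  have "((\<lambda>\<nu>. \<Sum>k\<in>UNIV. - 1/2 * ln ((\<nu> $ k)\<^sup>2 - 1/4)) has_derivative
      (\<lambda>b. \<Sum>k\<in>UNIV. - (one_mode_qfi (u $ k) * u $ k * b $ k))) (at u)"
    by (intro has_derivative_sum has_derivative_half_ln u'
        bounded_linear_imp_has_derivative bounded_linear_vec_nth)
  then have der: "((\<lambda>\<nu>. - 1/2 * (\<Sum>k\<in>UNIV. ln ((\<nu> $ k)\<^sup>2 - 1/4))) has_derivative
      (\<lambda>b. - ?F u u b)) (at u)"
    unfolding diag by (simp only: sum_distrib_left sum_negf)
  have Phi: "radial_Phi S =
      (\<lambda>p. - 1/2 * (\<Sum>k\<in>UNIV. ln ((coords radial_dom (radial_param S) p $ k)\<^sup>2 - 1/4)))"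
    by (simp add: radial_Phi_def fun_eq_iff)
  note ids = dilation_field_identities[where F = ?F and x = "radial_param S"
        and h = "\<lambda>\<nu>. - 1/2 * (\<Sum>k\<in>UNIV. ln ((\<nu> $ k)\<^sup>2 - 1/4))" and u = u,
      OF linear_radial_param inj_radial_param[OF S] open_radial_dom u bil pos der]
  show "radial_V S p = (- 1/4) *\<^sub>R radial_grad S F (radial_Phi S) p"
    unfolding pu radial_V_param[OF S u] radial_grad_def radial_bures_def Phi by (rule ids(1))
  show "(metric_norm (radial_bures S F) p (radial_V S p))\<^sup>2 =
      - 1/4 * differential radial_dom (radial_param S) (radial_Phi S) p (radial_V S p)"
    unfolding pu radial_V_param[OF S u] radial_bures_def Phi by (rule ids(2))
qed

theorem theorem12:
  fixes r \<phi> :: real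
    and S :: "real^('n::finite \<times> 2)^('n \<times> 2)"
    and F :: "real^'n \<Rightarrow> real^'n^'n"
  shows "(\<forall>p \<in> one_mode_family r \<phi>.
            one_mode_V r \<phi> p = (- 1/4) *\<^sub>R one_mode_grad r \<phi> (one_mode_Phi r \<phi>) p \<and>
            (metric_norm (one_mode_bures r \<phi>) p (one_mode_V r \<phi> p))\<^sup>2 =
              - 1/4 * differential one_mode_dom (one_mode_param r \<phi>) (one_mode_Phi r \<phi>) p
                        (one_mode_V r \<phi> p)) \<and>
         (symplectic S \<and> direct_sum_qfi F \<longrightarrow>
          (\<forall>p \<in> radial_manifold S.
            radial_V S p = (- 1/4) *\<^sub>R radial_grad S F (radial_Phi S) p \<and>
            (metric_norm (radial_bures S F) p (radial_V S p))\<^sup>2 =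
              - 1/4 * differential radial_dom (radial_param S) (radial_Phi S) p
                        (radial_V S p)))"
  using one_mode_identities radial_identities by blast

end
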